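(* Let $G$ be a graph on $n$ vertices with girth at least $5$. Then $\Delta(\mathcal{R}(G))\le n-\gamma(G)$.
   Context: All graphs are finite, simple and undirected; $N(v)$ denotes the open neighbourhood of $v$. A set $S\subseteq V(G)$ is a dominating set if every vertex of $G$ is in $S$ or adjacent to a vertex of $S$; it is a minimal dominating set if no proper subset of $S$ is a dominating set. $\gamma(G)$ is the domination number (minimum size of a dominating set) and $\Delta$ denotes maximum degree. The reconfiguration graph $\mathcal{R}(G)$ has as vertex set the collection of all minimal dominating sets of $G$, and two minimal dominating sets $M_1,M_2$ are adjacent iff there is a vertex $v$ with either ($M_2\setminus M_1=\{v\}$ and $M_1\setminus M_2\subseteq N(v)$) or ($M_1\setminus M_2=\{v\}$ and $M_2\setminus M_1\subseteq N(v)$). Girth at least 5 means $G$ has no cycles of length 3 or 4. *)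

theory Defs
  imports "Graph_Theory.Graph_Theory" "HOL-Library.Extended_Nat"
begin

text \<open>
  Finite simple undirected graphs are those satisfying the locale predicate \<^const>\<open>graph\<close>:
  finite, loop-free symmetric digraphs without parallel arcs, an undirected edge being a pair
  of opposite arcs. Hence the degree of a vertex is its out-degree.
\<close>

definition neighbourhood :: "('a,'b) pre_digraph \<Rightarrow> 'a \<Rightarrow> 'a set" where
  "neighbourhood G v = {u. v \<rightarrow>\<^bsub>G\<^esub> u}"

text \<open>The value is meaningful only for graphs with at least one vertex.\<close>

definition max_degree :: "('a,'b) pre_digraph \<Rightarrow> nat" where
  "max_degree G = Max (out_degree G ` verts G)"

text \<open>
  An undirected edge traversed back and forth is a \<^const>\<open>pre_digraph.cycle\<close> of length 2 of the
  symmetric digraph; the bound 3 discards these. An acyclic graph has girth \<open>\<infinity>\<close>.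
\<close>

definition girth :: "('a,'b) pre_digraph \<Rightarrow> enat" where
  "girth G = (INF p \<in> {p. pre_digraph.cycle G p \<and> 3 \<le> length p}. enat (length p))"

definition dominating_set :: "('a,'b) pre_digraph \<Rightarrow> 'a set \<Rightarrow> bool" where
  "dominating_set G S \<longleftrightarrow>
     S \<subseteq> verts G \<and> (\<forall>v \<in> verts G. v \<in> S \<or> (\<exists>u \<in> S. u \<in> neighbourhood G v))"

definition minimal_dominating_set :: "('a,'b) pre_digraph \<Rightarrow> 'a set \<Rightarrow> bool" where
  "minimal_dominating_set G S \<longleftrightarrow>
     dominating_set G S \<and> (\<forall>T. T \<subset> S \<longrightarrow> \<not> dominating_set G T)"

definition domination_number :: "('a,'b) pre_digraph \<Rightarrow> nat" where
  "domination_number G = Min (card ` {S. dominating_set G S})"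

definition reconf_adj :: "('a,'b) pre_digraph \<Rightarrow> 'a set \<Rightarrow> 'a set \<Rightarrow> bool" where
  "reconf_adj G M1 M2 \<longleftrightarrow>
     (\<exists>v. (M2 - M1 = {v} \<and> M1 - M2 \<subseteq> neighbourhood G v) \<or>
          (M1 - M2 = {v} \<and> M2 - M1 \<subseteq> neighbourhood G v))"

definition reconf_graph :: "('a,'b) pre_digraph \<Rightarrow> 'a set pair_pre_digraph" where
  "reconf_graph G =
     \<lparr> pverts = {M. minimal_dominating_set G M},
       parcs = {(M1, M2). minimal_dominating_set G M1 \<and> minimal_dominating_set G M2 \<and>
                          reconf_adj G M1 M2} \<rparr>"

lemma girth_ge_5_iff:
  "5 \<le> girth G \<longleftrightarrow> \<not> (\<exists>p. pre_digraph.cycle G p \<and> (length p = 3 \<or> length p = 4))"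
proof -
  have "5 \<le> girth G \<longleftrightarrow> (\<forall>p. pre_digraph.cycle G p \<and> 3 \<le> length p \<longrightarrow> 5 \<le> length p)"
    by (auto simp: girth_def le_INF_iff numeral_eq_enat)
  moreover have "(3 \<le> n \<longrightarrow> 5 \<le> n) \<longleftrightarrow> \<not> (n = 3 \<or> n = 4)" for n :: nat
    by presburger
  ultimately show ?thesis by blast
qed

context graph
begin

lemma finite_dominating_sets: "finite {S. dominating_set G S}"
  by (rule finite_subset[of _ "Pow (verts G)"]) (auto simp: dominating_set_def)

lemma ex_dominating_set_card_eq_domination_number:
  "\<exists>S. dominating_set G S \<and> card S = domination_number G"
proof -
  have "dominating_set G (verts G)" by (auto simp: dominating_set_def)
  then have "domination_number G \<in> card ` {S. dominating_set G S}"
    unfolding domination_number_def using finite_dominating_sets by (intro Min_in) auto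
  then show ?thesis by auto
qed

lemma domination_number_le:
  assumes "dominating_set G S"
  shows "domination_number G \<le> card S"
  unfolding domination_number_def using assms finite_dominating_sets by (intro Min_le) auto

lemma reconf_graph_nonempty: "verts (with_proj (reconf_graph G)) \<noteq> {}"
proof -
  obtain S where S: "dominating_set G S" "card S = domination_number G"
    using ex_dominating_set_card_eq_domination_number by blast
  then have "finite S" by (auto simp: dominating_set_def intro: finite_subset)
  then have "minimal_dominating_set G S"
    unfolding minimal_dominating_set_def
    using S domination_number_le psubset_card_mono by (metis leD)
  then show ?thesis by (auto simp: reconf_graph_def)
qed

lemma graph_reconf_graph: "graph (with_proj (reconf_graph G))"
proof -
  have fin: "finite {M. minimal_dominating_set G M}"
    by (rule finite_subset[OF _ finite_dominating_sets]) (auto simp: minimal_dominating_set_def)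
  have "finite (parcs (reconf_graph G))"
    by (rule finite_subset[OF _ finite_cartesian_product[OF fin fin]])
       (auto simp: reconf_graph_def)
  then have "pair_graph (reconf_graph G)"
    using fin
    by unfold_locales
       (auto simp: reconf_graph_def symmetric_def sym_def reconf_adj_def)
  then show ?thesis by (rule pair_graph.pair_graphD_graph)
qed

end

end

theory Submission
  imports Defs
begin

text \<open>
  Let \<open>M\<close> be a minimal dominating set. Sending a neighbour \<open>M'\<close> of \<open>M\<close> in the reconfiguration
  graph to an element of \<open>M' - M\<close> maps into the complement of \<open>M\<close>, so it suffices that this map is
  injective. If \<open>M' - M = {v}\<close>, then, as there are no cycles of length 3 or 4, the set \<open>M - M'\<close>
  consists of exactly those neighbours of \<open>v\<close> in \<open>M\<close> that have no external private neighbour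
  other than \<open>v\<close>. Otherwise \<open>M - M' = {v}\<close> for some \<open>v\<close>, and \<open>M' - M\<close> is the set of external
  private neighbours of \<open>v\<close>. Sets of external private neighbours of distinct vertices are disjoint,
  and adding an external private neighbour \<open>x\<close> of a vertex \<open>v\<close> that has a further one makes no
  vertex of \<open>M\<close> removable.
\<close>

text \<open>The equation with \<open>{u}\<close> forces \<open>u\<close> to lie in \<open>S\<close>,
  so the set is empty for every other \<open>u\<close>.\<close>

definition external_private_neighbours :: "('a,'b) pre_digraph \<Rightarrow> 'a set \<Rightarrow> 'a \<Rightarrow> 'a set" where
  "external_private_neighbours G S u = {w \<in> verts G - S. neighbourhood G w \<inter> S = {u}}"

lemma in_external_private_neighbours_iff:
  "w \<in> external_private_neighbours G S u \<longleftrightarrow>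
    w \<in> verts G \<and> w \<notin> S \<and> u \<in> S \<and> u \<in> neighbourhood G w \<and>
    (\<forall>x \<in> S. x \<in> neighbourhood G w \<longrightarrow> x = u)"
  unfolding external_private_neighbours_def by (simp add: set_eq_iff) metis

lemma dominating_setE:
  assumes "dominating_set G S" "w \<in> verts G" "w \<notin> S"
  obtains u where "u \<in> S" "u \<in> neighbourhood G w"
  using assms by (auto simp: dominating_set_def)

context graph
begin

section \<open>Neighbourhoods and short cycles\<close>

lemma neighbourhood_sym: "u \<in> neighbourhood G v \<Longrightarrow> v \<in> neighbourhood G u"
  using sym_arcs by (simp add: neighbourhood_def arcs_ends_symmetric)

lemma not_in_own_neighbourhood: "v \<notin> neighbourhood G v"
  using adj_not_same by (auto simp: neighbourhood_def)

lemma girth_ge_5_no_triangle: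
  assumes "5 \<le> girth G" "b \<in> neighbourhood G a" "c \<in> neighbourhood G b"
  shows "c \<notin> neighbourhood G a"
proof
  assume "c \<in> neighbourhood G a"
  then have "a \<in> neighbourhood G c" by (rule neighbourhood_sym)
  with assms obtain e f g where e: "e \<in> arcs G" "tail G e = a" "head G e = b"
    and f: "f \<in> arcs G" "tail G f = b" "head G f = c"
    and g: "g \<in> arcs G" "tail G g = c" "head G g = a"
    by (auto simp: neighbourhood_def arcs_ends_def arc_to_ends_def)
  have "a \<noteq> b" "b \<noteq> c" "c \<noteq> a"
    using assms \<open>c \<in> neighbourhood G a\<close> not_in_own_neighbourhood by auto
  then have "cycle [e, f, g]"
    using e f g by (auto simp: cycle_def awalk_def intro!: exI[of _ a])
  then show False using assms(1) unfolding girth_ge_5_iff by force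
qed

lemma girth_ge_5_common_neighbour_unique:
  assumes "5 \<le> girth G" "a \<noteq> c"
    and "b \<in> neighbourhood G a" "b \<in> neighbourhood G c"
    and "d \<in> neighbourhood G a" "d \<in> neighbourhood G c"
  shows "b = d"
proof (rule ccontr)
  assume "b \<noteq> d"
  have "c \<in> neighbourhood G b" "a \<in> neighbourhood G d"
    using assms neighbourhood_sym by blast+
  with assms obtain e f g h where e: "e \<in> arcs G" "tail G e = a" "head G e = b"
    and f: "f \<in> arcs G" "tail G f = b" "head G f = c"
    and g: "g \<in> arcs G" "tail G g = c" "head G g = d"
    and h: "h \<in> arcs G" "tail G h = d" "head G h = a"
    by (auto simp: neighbourhood_def arcs_ends_def arc_to_ends_def)
  have "a \<noteq> b" "b \<noteq> c" "c \<noteq> d" "d \<noteq> a" using assms not_in_own_neighbourhood by auto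
  then have "cycle [e, f, g, h]"
    using e f g h \<open>a \<noteq> c\<close> \<open>b \<noteq> d\<close> by (auto simp: cycle_def awalk_def intro!: exI[of _ a])
  then show False using assms(1) unfolding girth_ge_5_iff by force
qed

section \<open>Neighbouring minimal dominating sets\<close>

text \<open>If \<open>u\<close> in \<open>D\<close> has an external private neighbour
  \<open>w\<close> other than \<open>v\<close>, only \<open>v\<close> could dominate
  \<open>w\<close> afterwards, giving a triangle. Conversely, an undominated \<open>w\<close> shares
  all its neighbours in \<open>M\<close> with \<open>v\<close>; without 4-cycles there is just one,
  so \<open>w\<close> is private to it.\<close>

lemma dominating_set_insert_Diff_iff:
  assumes girth: "5 \<le> girth G"
    and dom: "dominating_set G M" and v: "v \<in> verts G - M"
    and D: "D \<subseteq> M \<inter> neighbourhood G v"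
  shows "dominating_set G (insert v M - D) \<longleftrightarrow>
    (\<forall>u \<in> D. external_private_neighbours G M u \<subseteq> {v})" (is "?L \<longleftrightarrow> ?R")
proof
  assume L: ?L
  show ?R
  proof (intro ballI subsetI, rule ccontr)
    fix u w assume u: "u \<in> D" and w: "w \<in> external_private_neighbours G M u" and "w \<notin> {v}"
    from w have w': "w \<in> verts G" "w \<notin> M" "u \<in> neighbourhood G w"
      "\<And>x. x \<in> M \<Longrightarrow> x \<in> neighbourhood G w \<Longrightarrow> x = u"
      by (simp_all add: in_external_private_neighbours_iff)
    have "w \<notin> insert v M - D" using w' \<open>w \<notin> {v}\<close> by simp
    from L w'(1) this obtain y where y: "y \<in> insert v M - D" "y \<in> neighbourhood G w"
      by (rule dominating_setE)
    then have "v \<in> neighbourhood G w" using u w'(4) by (cases "y = v") auto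
    moreover have "u \<in> neighbourhood G v" using u D by blast
    ultimately show False using girth_ge_5_no_triangle[OF girth] w'(3) by blast
  qed
next
  assume R: ?R
  have "w \<in> insert v M - D \<or> (\<exists>u \<in> insert v M - D. u \<in> neighbourhood G w)"
    if w: "w \<in> verts G" for w
  proof (rule ccontr)
    assume neg: "\<not> ?thesis"
    then have "w \<noteq> v" "v \<notin> neighbourhood G w" using v D by blast+
    then have "w \<notin> D" using D neighbourhood_sym by blast
    then have "w \<notin> M" using neg by blast
    from dom w this obtain u where u: "u \<in> M" "u \<in> neighbourhood G w"
      by (rule dominating_setE)
    have sub: "neighbourhood G w \<inter> M \<subseteq> D" using neg by blast
    have "x = u" if "x \<in> M" "x \<in> neighbourhood G w" for x
      using girth_ge_5_common_neighbour_unique[OF girth \<open>w \<noteq> v\<close>, of x u] that u sub D by blast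
    then have "w \<in> external_private_neighbours G M u"
      unfolding in_external_private_neighbours_iff using w \<open>w \<notin> M\<close> u by blast
    then show False using R sub u \<open>w \<noteq> v\<close> by blast
  qed
  then show ?L using dom v unfolding dominating_set_def by blast
qed

text \<open>The removable vertices can all be removed at once, and \<open>M'\<close> has lost only
  such vertices, so minimality of \<open>M'\<close> forces that it has lost all of them. Hence
  \<open>v\<close> determines \<open>M'\<close>.\<close>

lemma minimal_dominating_set_single_insertion:
  assumes girth: "5 \<le> girth G"
    and dom: "dominating_set G M" and min: "minimal_dominating_set G M'"
    and ins: "M' - M = {v}" and del: "M - M' \<subseteq> neighbourhood G v"
  shows "M - M' =
    {u \<in> M \<inter> neighbourhood G v. external_private_neighbours G M u \<subseteq> {v}}" (is "_ = ?D")
proof -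
  have dom': "dominating_set G M'" using min by (simp add: minimal_dominating_set_def)
  have v: "v \<in> verts G - M" using ins dom' by (auto simp: dominating_set_def)
  have M': "M' = insert v M - (M - M')" using ins by blast
  have "dominating_set G (insert v M - (M - M'))" using dom' M' by simp
  then have sub: "M - M' \<subseteq> ?D"
    using dominating_set_insert_Diff_iff[OF girth dom v, of "M - M'"] del by blast
  have "dominating_set G (insert v M - ?D)"
    by (subst dominating_set_insert_Diff_iff[OF girth dom v]) auto
  moreover have "insert v M - ?D \<subseteq> M'" using sub M' by blast
  ultimately have "insert v M - ?D = M'"
    using min by (auto simp: minimal_dominating_set_def)
  then show ?thesis using v by blast
qed

lemma minimal_dominating_set_single_deletion:
  assumes girth: "5 \<le> girth G"
    and dom: "dominating_set G M" and min: "minimal_dominating_set G M'"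
    and del: "M - M' = {v}" and ins: "M' - M \<subseteq> neighbourhood G v"
    and nsingle: "\<nexists>x. M' - M = {x}"
  shows "M' - M = external_private_neighbours G M v"
proof
  have dom': "dominating_set G M'" using min by (simp add: minimal_dominating_set_def)
  show sup: "external_private_neighbours G M v \<subseteq> M' - M"
  proof (rule subsetI, rule ccontr)
    fix w assume w: "w \<in> external_private_neighbours G M v" "w \<notin> M' - M"
    then have w': "w \<in> verts G" "w \<notin> M" "w \<notin> M'" "v \<in> neighbourhood G w"
      "\<And>x. x \<in> M \<Longrightarrow> x \<in> neighbourhood G w \<Longrightarrow> x = v"
      by (simp_all add: in_external_private_neighbours_iff)
    from dom' w'(1,3) obtain a where a: "a \<in> M'" "a \<in> neighbourhood G w"
      by (rule dominating_setE)
    have "v \<notin> M'" using del by blast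
    then have "a \<in> M' - M" using w'(5) a by blast
    then have "a \<in> neighbourhood G v" using ins by blast
    \<comment> \<open>The vertices \<open>w\<close>, \<open>v\<close> and \<open>a\<close> form a
      triangle.\<close>
    then show False
      using girth_ge_5_no_triangle[OF girth neighbourhood_sym[OF w'(4)] a(2)] by blast
  qed
  show "M' - M \<subseteq> external_private_neighbours G M v"
  proof
    fix a assume a: "a \<in> M' - M"
    then have "\<not> dominating_set G (M' - {a})"
      using min by (auto simp: minimal_dominating_set_def)
    then obtain w where w: "w \<in> verts G" "w \<notin> M' - {a}"
      "\<And>u. u \<in> M' - {a} \<Longrightarrow> u \<notin> neighbourhood G w"
      using dom' unfolding dominating_set_def by blast
    \<comment> \<open>If \<open>w = v\<close>, then \<open>a\<close> would be the only vertex of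
      \<open>M'\<close> adjacent to \<open>v\<close>, hence the only inserted one;
      \<open>nsingle\<close> excludes this.\<close>
    have "w \<noteq> v"
    proof
      assume "w = v"
      then have "M' - M = {a}" using w(3) ins a by blast
      then show False using nsingle by blast
    qed
    moreover have keep: "M - {v} \<subseteq> M' - {a}" using del a by blast
    ultimately have "w \<notin> M" using w(2) by blast
    from dom w(1) this obtain u where "u \<in> M" "u \<in> neighbourhood G w"
      by (rule dominating_setE)
    moreover have "x = v" if "x \<in> M" "x \<in> neighbourhood G w" for x
      using w(3) keep that by blast
    ultimately have epn: "w \<in> external_private_neighbours G M v"
      unfolding in_external_private_neighbours_iff using w(1) \<open>w \<notin> M\<close> by blast
    \<comment> \<open>By the first inclusion \<open>w\<close> lies in \<open>M'\<close>, but it is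
      outside \<open>M' - {a}\<close>.\<close>
    then have "w = a" using sup w(2) by blast
    then show "a \<in> external_private_neighbours G M v" using epn by simp
  qed
qed

text \<open>The only neighbour of \<open>x\<close> in \<open>M\<close> is \<open>v\<close>. With a
  further external private neighbour it could not be removed, so \<open>M'\<close> would properly
  contain the dominating set \<open>M\<close>.\<close>

lemma single_insertion_external_private_neighbour:
  assumes girth: "5 \<le> girth G"
    and dom: "dominating_set G M" and min: "minimal_dominating_set G M'"
    and ins: "M' - M = {x}" and del: "M - M' \<subseteq> neighbourhood G x"
    and x: "x \<in> external_private_neighbours G M v"
  shows "external_private_neighbours G M v = {x}"
proof (rule ccontr)
  assume "external_private_neighbours G M v \<noteq> {x}"
  then have "\<not> external_private_neighbours G M v \<subseteq> {x}" using x by blast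
  moreover have "u = v" if "u \<in> M" "u \<in> neighbourhood G x" for u
    using x that unfolding in_external_private_neighbours_iff by blast
  ultimately have
    "{u \<in> M \<inter> neighbourhood G x. external_private_neighbours G M u \<subseteq> {x}} = {}"
    by blast
  then have "M - M' = {}"
    using minimal_dominating_set_single_insertion[OF girth dom min ins del] by simp
  then have "M \<subset> M'" using ins by blast
  then show False using min dom by (auto simp: minimal_dominating_set_def)
qed

text \<open>A swap of two single vertices has both forms; it is counted as an insertion, which makes
  the cases exclusive.\<close>

lemma reconf_adj_cases:
  assumes girth: "5 \<le> girth G"
    and dom: "dominating_set G M" and min: "minimal_dominating_set G M'"
    and adj: "reconf_adj G M M'"
  obtains (insertion) v where "M' - M = {v}" "M - M' \<subseteq> neighbourhood G v"
    | (deletion) v where "M - M' = {v}" "M' - M = external_private_neighbours G M v"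
        "\<nexists>x. M' - M = {x}"
proof (cases "\<exists>v. M' - M = {v} \<and> M - M' \<subseteq> neighbourhood G v")
  case True
  then show thesis using insertion by blast
next
  case False
  then obtain v where v: "M - M' = {v}" "M' - M \<subseteq> neighbourhood G v"
    using adj unfolding reconf_adj_def by blast
  have "\<nexists>x. M' - M = {x}"
  proof
    assume "\<exists>x. M' - M = {x}"
    then obtain x where x: "M' - M = {x}" by (rule exE)
    then have "v \<in> neighbourhood G x" using v(2) neighbourhood_sym by simp
    then show False using False x v(1) by simp
  qed
  then show thesis
    using deletion[OF v(1)] minimal_dominating_set_single_deletion[OF girth dom min v] by simp
qed

text \<open>Two insertions both insert \<open>x\<close>, which determines the removed vertices. In a
  mixed pair, \<open>x\<close> would be the only external private neighbour of the deleted vertex,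
  so the deletion would insert a single vertex, which its case excludes.\<close>

lemma reconf_neighbour_determined_by_inserted_vertex:
  assumes girth: "5 \<le> girth G" and dom: "dominating_set G M"
    and min1: "minimal_dominating_set G M1" and adj1: "reconf_adj G M M1"
    and min2: "minimal_dominating_set G M2" and adj2: "reconf_adj G M M2"
    and x: "x \<in> M1 - M" "x \<in> M2 - M"
  shows "M1 = M2"
proof -
  have diffs: "M1 = M2" if "M - M1 = M - M2" "M1 - M = M2 - M" using that by blast
  show ?thesis
  proof (cases rule: reconf_adj_cases[OF girth dom min1 adj1])
    case ins1: (1 v)
    then have v: "v = x" using x(1) by (metis singletonD)
    show ?thesis
    proof (cases rule: reconf_adj_cases[OF girth dom min2 adj2])
      case ins2: (1 w)
      then have "w = x" using x(2) by (metis singletonD)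
      then show ?thesis
        using minimal_dominating_set_single_insertion[OF girth dom min1 ins1]
          minimal_dominating_set_single_insertion[OF girth dom min2 ins2] diffs ins1 ins2 v
        by simp
    next
      case (2 w)
      then show ?thesis
        using single_insertion_external_private_neighbour[OF girth dom min1 ins1] x v by metis
    qed
  next
    case del1: (2 v)
    show ?thesis
    proof (cases rule: reconf_adj_cases[OF girth dom min2 adj2])
      case ins2: (1 w)
      then have "w = x" using x(2) by (metis singletonD)
      then show ?thesis
        using single_insertion_external_private_neighbour[OF girth dom min2 ins2] x del1 by metis
    next
      case (2 w)
      \<comment> \<open>The vertex \<open>x\<close> has exactly one neighbour in \<open>M\<close>,
        and both \<open>v\<close> and \<open>w\<close> are it.\<close>
      then have "v = w" using del1(2) x by (metis in_external_private_neighbours_iff)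
      then show ?thesis using diffs del1 2 by simp
    qed
  qed
qed

section \<open>Counting neighbours\<close>

lemma out_degree_reconf_graph_le:
  assumes girth: "5 \<le> girth G" and M: "minimal_dominating_set G M"
  shows "out_degree (with_proj (reconf_graph G)) M \<le> card (verts G) - card M"
proof -
  define A where "A = {M'. minimal_dominating_set G M' \<and> reconf_adj G M M'}"
  have dom: "dominating_set G M" using M by (simp add: minimal_dominating_set_def)
  have "out_arcs (with_proj (reconf_graph G)) M = Pair M ` A"
    using M by (auto simp: out_arcs_def reconf_graph_def A_def)
  then have deg: "out_degree (with_proj (reconf_graph G)) M = card A"
    by (simp add: out_degree_def card_image inj_on_def)
  have "\<exists>x. x \<in> M' - M" if "M' \<in> A" for M'
  proof (rule ccontr)
    assume "\<not> ?thesis"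
    \<comment> \<open>Equality is impossible, since adjacency makes one of the two differences a
      singleton.\<close>
    then have "M' \<subset> M" using that by (auto simp: A_def reconf_adj_def)
    then show False using M that by (auto simp: A_def minimal_dominating_set_def)
  qed
  \<comment> \<open>A deletion may insert several vertices; any choice among them gives an injective
    map.\<close>
  then obtain f where f: "\<And>M'. M' \<in> A \<Longrightarrow> f M' \<in> M' - M" by metis
  have "inj_on f A"
  proof (rule inj_onI)
    fix M1 M2 assume "M1 \<in> A" "M2 \<in> A" "f M1 = f M2"
    then show "M1 = M2"
      using reconf_neighbour_determined_by_inserted_vertex[OF girth dom, of M1 M2 "f M1"]
        f[of M1] f[of M2] by (simp add: A_def)
  qed
  moreover have "f ` A \<subseteq> verts G - M"
  proof (rule image_subsetI)
    fix M' assume "M' \<in> A"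
    moreover from this have "M' \<subseteq> verts G"
      by (simp add: A_def minimal_dominating_set_def dominating_set_def)
    ultimately show "f M' \<in> verts G - M" using f[of M'] by blast
  qed
  ultimately have "card A \<le> card (verts G - M)" by (intro card_inj_on_le) auto
  also have "\<dots> = card (verts G) - card M"
    using dom by (intro card_Diff_subset) (auto simp: dominating_set_def intro: finite_subset)
  finally show ?thesis using deg by simp
qed

end

theorem theorem14:
  fixes G :: "('a, 'b) pre_digraph" and n :: nat
  assumes "graph G"
    and "card (verts G) = n"
    and "5 \<le> girth G"
  shows "max_degree (with_proj (reconf_graph G)) \<le> n - domination_number G"
proof -
  interpret graph G by fact
  interpret R: graph "with_proj (reconf_graph G)" by (rule graph_reconf_graph)
  have "out_degree (with_proj (reconf_graph G)) M \<le> n - domination_number G"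
    if "M \<in> verts (with_proj (reconf_graph G))" for M
  proof -
    have M: "minimal_dominating_set G M" using that by (simp add: reconf_graph_def)
    then have "domination_number G \<le> card M"
      by (simp add: minimal_dominating_set_def domination_number_le)
    then show ?thesis using out_degree_reconf_graph_le[OF assms(3) M] assms(2) by linarith
  qed
  then show ?thesis
    unfolding max_degree_def using reconf_graph_nonempty R.finite_verts by (subst Max_le_iff) auto
qed

end
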